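(* Let $V_1,\ldots,V_k$ be subsemimodules of $\mathbf{R}_{\max,\mathrm{m}}^n$ that are closed in the Euclidean topology and satisfy $V_1\cap\cdots\cap V_k=\{0\}$. Then there exist archimedean halfspaces $H_1,\ldots,H_k\subseteq\mathbf{R}_{\max,\mathrm{m}}^n$ such that $V_i\subseteq H_i$ for all $i=1,\ldots,k$ and $H_1\cap\cdots\cap H_k=\{0\}$.
   Context: $\mathbf{R}_{\max,\mathrm{m}}$ is the max-times semiring: the set $\mathbf{R}_+$ of nonnegative reals with addition $a\oplus b=\max(a,b)$ and the usual multiplication. $\mathbf{R}_{\max,\mathrm{m}}^n$ is $\mathbf{R}_+^n$ with entrywise $\oplus$ and scalar multiplication. A subsemimodule is a subset containing $0$ and closed under $\oplus$ and under multiplication by scalars from $\mathbf{R}_+$. An archimedean halfspace is a set of the form $H=\{x\in\mathbf{R}_+^n \mid \max_{1\le i\le n} x_iu_i^{-1}\le \max_{1\le i\le n} x_iv_i^{-1}\}$, where $u,v\in\mathbf{R}_+^n$ have all entries positive and $u\le v$ entrywise. *)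

theory Defs
  imports "HOL-Analysis.Analysis"
begin

text \<open>
  The max-times semimodule of nonnegative vectors is represented by its carrier set inside
  the Euclidean space \<^typ>\<open>real ^ 'n\<close>, so that being closed is the library's
  notion; since the carrier is itself closed, closedness in the subspace topology is the same.
\<close>

definition nonneg_vecs :: "(real ^ 'n) set" where
  "nonneg_vecs = {x. \<forall>i. 0 \<le> x $ i}"

definition vec_max :: "real ^ 'n \<Rightarrow> real ^ 'n \<Rightarrow> real ^ 'n" (infixl "\<oplus>\<^sub>m" 65) where
  "x \<oplus>\<^sub>m y = (\<chi> i. max (x $ i) (y $ i))"

definition subsemimodule :: "(real ^ 'n) set \<Rightarrow> bool" where
  "subsemimodule V \<longleftrightarrow>
     V \<subseteq> nonneg_vecs \<and> 0 \<in> V \<and>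
     (\<forall>x\<in>V. \<forall>y\<in>V. x \<oplus>\<^sub>m y \<in> V) \<and>
     (\<forall>c\<ge>0. \<forall>x\<in>V. c *\<^sub>R x \<in> V)"

definition archimedean_halfspace :: "(real ^ 'n) set \<Rightarrow> bool" where
  "archimedean_halfspace H \<longleftrightarrow>
     (\<exists>u v :: real ^ 'n.
        (\<forall>i. 0 < u $ i) \<and> (\<forall>i. 0 < v $ i) \<and> (\<forall>i. u $ i \<le> v $ i) \<and>
        H = {x \<in> nonneg_vecs.
               (MAX i. x $ i * inverse (u $ i)) \<le> (MAX i. x $ i * inverse (v $ i))})"

end

theory Submission
  imports Defs
begin

text \<open>
  The relaxed projector of a closed semimodule \<open>V\<close> sends \<open>x\<close> to the maximum of
  \<open>x / 2\<close> and the greatest element of \<open>V\<close> below \<open>x\<close>. It preserves positivity,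
  and \<open>V\<close> lies in the archimedean halfspace with data \<open>u = Q x\<close>, \<open>v = x\<close>.
  Let \<open>T\<close> be the composition of the relaxed projectors of \<open>V\<^sub>1, \<dots>, V\<^sub>k\<close>. The iterates
  of \<open>T\<close> at the all-ones vector decrease to a limit which lies in every \<open>V\<^sub>i\<close>, hence to
  \<open>0\<close>. A minimum of finitely many rescaled iterates is then a positive vector \<open>y\<close> with
  \<open>T y < y\<close> entrywise. The successive images of \<open>y\<close> under the relaxed projectors define
  the halfspaces: on their intersection \<open>max x\<^sub>j / (T y)\<^sub>j \<le> max x\<^sub>j / y\<^sub>j\<close>, so \<open>x = 0\<close>.
\<close>

section \<open>Projectors onto closed semimodules\<close>

text \<open>\<open>GREATEST\<close> refers to the entrywise order, which is only partial;
  \<open>exists_greatest_below\<close> makes the choice meaningful for closed \<open>V\<close> and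
  \<open>x\<close> \<ge> 0.\<close>

definition max_projector :: "(real ^ 'n) set \<Rightarrow> real ^ 'n \<Rightarrow> real ^ 'n" where
  "max_projector V x = (GREATEST p. p \<in> V \<and> p \<le> x)"

definition relaxed_projector :: "(real ^ 'n) set \<Rightarrow> real ^ 'n \<Rightarrow> real ^ 'n" where
  "relaxed_projector V x = max_projector V x \<oplus>\<^sub>m (1/2) *\<^sub>R x"

lemma vec_max_nth [simp]: "(x \<oplus>\<^sub>m y) $ i = max (x $ i) (y $ i)"
  by (simp add: vec_max_def)

lemma exists_upper_bound_in_semimodule:
  fixes f :: "'a \<Rightarrow> real ^ 'n"
  assumes V: "subsemimodule V" and "finite I" and "\<And>i. i \<in> I \<Longrightarrow> f i \<in> V \<and> f i \<le> x" and "0 \<le> x"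
  shows "\<exists>p\<in>V. p \<le> x \<and> (\<forall>i\<in>I. f i \<le> p)"
  using assms(2,3)
proof (induction I rule: finite_induct)
  case empty
  then show ?case using V \<open>0 \<le> x\<close> by (auto simp: subsemimodule_def)
next
  case (insert a I)
  then obtain p where p: "p \<in> V" "p \<le> x" "\<forall>i\<in>I. f i \<le> p" by auto
  have "f a \<oplus>\<^sub>m p \<in> V" using V p insert.prems by (auto simp: subsemimodule_def)
  moreover have "f a \<oplus>\<^sub>m p \<le> x" using p insert.prems by (auto simp: less_eq_vec_def)
  moreover have "\<forall>i\<in>insert a I. f i \<le> f a \<oplus>\<^sub>m p"
    using p by (auto simp: less_eq_vec_def le_max_iff_disj)
  ultimately show ?case by blast
qed

text \<open>The elements of \<open>V\<close> below \<open>x\<close> form a compact set, so each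
  coordinate has a maximizer there. The join of these finitely many maximizers stays in
  \<open>V\<close> and below \<open>x\<close>, and it dominates every coordinate at once.\<close>

lemma exists_greatest_below:
  fixes V :: "(real ^ 'n) set"
  assumes V: "subsemimodule V" "closed V" and x: "0 \<le> x"
  shows "\<exists>p\<in>V. p \<le> x \<and> (\<forall>y\<in>V. y \<le> x \<longrightarrow> y \<le> p)"
proof -
  let ?K = "V \<inter> {0..x}"
  have K: "y \<in> ?K" if "y \<in> V" "y \<le> x" for y
    using V that by (auto simp: subsemimodule_def nonneg_vecs_def less_eq_vec_def)
  have "compact ?K" using V(2) by (simp add: closed_Int_compact)
  moreover have "?K \<noteq> {}" using V(1) x by (auto simp: subsemimodule_def)
  ultimately have "\<exists>m\<in>?K. \<forall>y\<in>?K. y $ i \<le> m $ i" for i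
    by (intro continuous_attains_sup continuous_intros)
  then obtain m where m: "\<And>i. m i \<in> ?K" "\<And>i y. y \<in> ?K \<Longrightarrow> y $ i \<le> m i $ i" by metis
  obtain p where p: "p \<in> V" "p \<le> x" "\<forall>i. m i \<le> p"
    using exists_upper_bound_in_semimodule[OF V(1), of UNIV m x] m(1) x by auto
  have "y \<le> p" if "y \<in> V" "y \<le> x" for y
    using m(2)[OF K[OF that]] p(3) unfolding less_eq_vec_def by (meson order_trans)
  then show ?thesis using p by blast
qed

context
  fixes V :: "(real ^ 'n) set"
  assumes V: "subsemimodule V" "closed V"
begin

lemma max_projector:
  assumes "0 \<le> x"
  shows max_projector_in: "max_projector V x \<in> V"
    and max_projector_le: "max_projector V x \<le> x"
    and max_projector_greatest: "\<And>y. y \<in> V \<Longrightarrow> y \<le> x \<Longrightarrow> y \<le> max_projector V x"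
proof -
  obtain p where p: "p \<in> V" "p \<le> x" "\<forall>y\<in>V. y \<le> x \<longrightarrow> y \<le> p"
    using exists_greatest_below[OF V assms] by blast
  then have "max_projector V x = p"
    unfolding max_projector_def by (intro Greatest_equality) auto
  then show "max_projector V x \<in> V" "max_projector V x \<le> x"
    "\<And>y. y \<in> V \<Longrightarrow> y \<le> x \<Longrightarrow> y \<le> max_projector V x"
    using p by auto
qed

lemma max_projector_nonneg: "0 \<le> x \<Longrightarrow> 0 \<le> max_projector V x"
  using max_projector_greatest[of x 0] V(1) by (auto simp: subsemimodule_def)

lemma max_projector_mono:
  assumes "0 \<le> x" "x \<le> y"
  shows "max_projector V x \<le> max_projector V y"
  using assms max_projector by (meson order_trans)

text \<open>Dividing the projection of \<open>c *\<^sub>R x\<close> by \<open>c\<close> gives an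
  element of \<open>V\<close> below \<open>x\<close>, hence one below the projection of
  \<open>x\<close>.\<close>

lemma max_projector_scale_le:
  assumes x: "0 \<le> x" and c: "0 < c"
  shows "max_projector V (c *\<^sub>R x) \<le> c *\<^sub>R max_projector V x"
proof -
  let ?p = "max_projector V (c *\<^sub>R x)"
  have cx: "0 \<le> c *\<^sub>R x" using x c by (simp add: less_eq_vec_def)
  have "inverse c *\<^sub>R ?p \<in> V"
    using V(1) max_projector_in[OF cx] c by (simp add: subsemimodule_def)
  moreover have "inverse c *\<^sub>R ?p \<le> x"
    using max_projector_le[OF cx] c by (simp add: less_eq_vec_def field_simps)
  ultimately have "inverse c *\<^sub>R ?p \<le> max_projector V x"
    using max_projector_greatest[OF x] by blast
  then show ?thesis using c by (simp add: less_eq_vec_def field_simps)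
qed

lemma relaxed_projector_le: "0 \<le> x \<Longrightarrow> relaxed_projector V x \<le> x"
  using max_projector_le[of x] by (simp add: relaxed_projector_def less_eq_vec_def)

lemma relaxed_projector_pos: "\<forall>i. 0 < x $ i \<Longrightarrow> 0 < relaxed_projector V x $ i"
  by (simp add: relaxed_projector_def less_max_iff_disj)

lemma relaxed_projector_mono:
  "0 \<le> x \<Longrightarrow> x \<le> y \<Longrightarrow> relaxed_projector V x \<le> relaxed_projector V y"
  using max_projector_mono[of x y]
  by (auto simp: relaxed_projector_def less_eq_vec_def simp del: max.bounded_iff intro!: max.mono)

lemma relaxed_projector_scale_le:
  "0 \<le> x \<Longrightarrow> 0 < c \<Longrightarrow> relaxed_projector V (c *\<^sub>R x) \<le> c *\<^sub>R relaxed_projector V x"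
  using max_projector_scale_le[of x c]
  by (auto simp: relaxed_projector_def less_eq_vec_def max_mult_distrib_left max.coboundedI1)

lemma le_scale_relaxed_projector:
  assumes y: "y \<in> V" "y \<le> c *\<^sub>R x" and x: "0 \<le> x" and c: "0 \<le> c"
  shows "y \<le> c *\<^sub>R relaxed_projector V x"
\<comment> \<open>Scaling of the projector needs \<open>c\<close> > 0; for \<open>c\<close> = 0 both
  upper bounds on \<open>y\<close> are 0.\<close>
proof (cases "c = 0")
  case False
  then have "0 \<le> c *\<^sub>R x" "0 < c" using x c by (auto simp: less_eq_vec_def)
  then have "y \<le> c *\<^sub>R max_projector V x"
    using y x max_projector_greatest max_projector_scale_le by (meson order_trans)
  also have "\<dots> \<le> c *\<^sub>R relaxed_projector V x"
    using c by (auto simp: relaxed_projector_def less_eq_vec_def intro: mult_left_mono)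
  finally show ?thesis .
qed (use y in simp)

text \<open>
  Where the limit is positive, \<open>x / 2\<close> is eventually too small to be the maximum in the
  relaxed projector, so the true projections have the same limit.
\<close>

lemma relaxed_projector_limit_in:
  fixes z :: "nat \<Rightarrow> real ^ 'n"
  assumes z: "\<And>m. 0 \<le> z m" and lim: "z \<longlonglongrightarrow> w" "(\<lambda>m. relaxed_projector V (z m)) \<longlonglongrightarrow> w"
  shows "w \<in> V"
proof (rule closed_sequentially[OF V(2)])
  show "max_projector V (z m) \<in> V" for m using max_projector_in[OF z] .
  show "(\<lambda>m. max_projector V (z m)) \<longlonglongrightarrow> w"
  proof (rule vec_tendstoI)
    fix i
    have zi: "(\<lambda>m. z m $ i) \<longlonglongrightarrow> w $ i"
      and qi: "(\<lambda>m. relaxed_projector V (z m) $ i) \<longlonglongrightarrow> w $ i"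
      using lim by (auto intro: tendsto_vec_nth)
    have nonneg: "0 \<le> z m $ i" "0 \<le> max_projector V (z m) $ i"
      and le: "max_projector V (z m) $ i \<le> z m $ i" for m
      using z[of m] max_projector_nonneg[OF z] max_projector_le[OF z]
      by (auto simp: less_eq_vec_def)
    have "0 \<le> w $ i" using zi nonneg(1) by (intro LIMSEQ_le_const) auto
    then consider "w $ i = 0" | "0 < w $ i" by linarith
    then show "(\<lambda>m. max_projector V (z m) $ i) \<longlonglongrightarrow> w $ i"
    proof cases
      case 1
      then show ?thesis
        using tendsto_sandwich[OF _ _ tendsto_const[of 0] zi[unfolded 1]] nonneg le by auto
    next
      case 2
      have "(\<lambda>m. relaxed_projector V (z m) $ i - z m $ i / 2) \<longlonglongrightarrow> w $ i - w $ i / 2"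
        by (intro tendsto_intros qi zi) auto
      then have "\<forall>\<^sub>F m in sequentially. 0 < relaxed_projector V (z m) $ i - z m $ i / 2"
        by (rule order_tendstoD) (use 2 in simp)
      then have "\<forall>\<^sub>F m in sequentially.
          relaxed_projector V (z m) $ i = max_projector V (z m) $ i"
        by eventually_elim (auto simp: relaxed_projector_def max_def split: if_splits)
      then show ?thesis using qi tendsto_cong by fast
    qed
  qed
qed

end

section \<open>Halfspaces\<close>

text \<open>This is the set in \<open>archimedean_halfspace\<close> with its data made explicit and
  without the conditions on them, which are checked separately.\<close>

definition halfspace :: "real ^ 'n \<Rightarrow> real ^ 'n \<Rightarrow> (real ^ 'n) set" where
  "halfspace u v = {x \<in> nonneg_vecs.
     (MAX i. x $ i * inverse (u $ i)) \<le> (MAX i. x $ i * inverse (v $ i))}"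

text \<open>The maximal quotient \<open>c\<close> of \<open>y\<close> by \<open>v\<close> satisfies
  \<open>y \<le> c *\<^sub>R v\<close>. As \<open>y\<close> lies in \<open>V\<close>, the same
  \<open>c\<close> works with \<open>v\<close> replaced by its relaxed projection, so it also bounds
  the quotients by the latter.\<close>

lemma subset_halfspace_relaxed_projector:
  assumes V: "subsemimodule V" "closed V" and v: "\<forall>i. 0 < v $ i"
  shows "V \<subseteq> halfspace (relaxed_projector V v) v"
proof
  fix y assume y: "y \<in> V"
  define c where "c = (MAX i. y $ i * inverse (v $ i))"
  have nonneg: "0 \<le> y $ i" for i
    using V y by (auto simp: subsemimodule_def nonneg_vecs_def)
  have c: "y $ i * inverse (v $ i) \<le> c" for i by (simp add: c_def)
  have "0 \<le> y $ i * inverse (v $ i)" for i using nonneg v by (simp add: less_imp_le)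
  then have "0 \<le> c" using c order_trans by blast
  moreover have "y \<le> c *\<^sub>R v"
    using c v by (simp add: less_eq_vec_def field_simps)
  ultimately have "y \<le> c *\<^sub>R relaxed_projector V v"
    using le_scale_relaxed_projector[OF V y] v by (simp add: less_eq_vec_def less_imp_le)
  then have "(MAX i. y $ i * inverse (relaxed_projector V v $ i)) \<le> c"
    using relaxed_projector_pos[OF V v] by (auto simp: less_eq_vec_def field_simps)
  then show "y \<in> halfspace (relaxed_projector V v) v"
    using nonneg by (simp add: halfspace_def c_def nonneg_vecs_def)
qed

text \<open>At an index \<open>j\<close> maximizing the quotient by \<open>v\<close>, the entry of
  \<open>x\<close> is positive because \<open>x\<close> is nonzero, so replacing \<open>v\<close> by
  the smaller \<open>u\<close> strictly raises that quotient.\<close>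

lemma max_quotient_less:
  fixes x u v :: "real ^ 'n"
  assumes x: "x \<in> nonneg_vecs" "x \<noteq> 0" and u: "\<forall>i. 0 < u $ i" and uv: "\<forall>i. u $ i < v $ i"
  shows "(MAX i. x $ i * inverse (v $ i)) < (MAX i. x $ i * inverse (u $ i))"
proof -
  let ?f = "\<lambda>i. x $ i * inverse (v $ i)"
  have v: "0 < v $ i" for i using u uv by (meson less_trans)
  have "(MAX i. ?f i) \<in> range ?f" by (rule Max_in) auto
  then obtain j where j: "(MAX i. ?f i) = ?f j" by blast
  obtain l where "x $ l \<noteq> 0" using x(2) by (auto simp: vec_eq_iff)
  then have "0 < ?f l"
    using x(1) v by (simp add: nonneg_vecs_def less_le)
  also have "?f l \<le> ?f j" unfolding j[symmetric] by simp
  finally have "0 < x $ j" using v[of j] by (simp add: zero_less_mult_iff)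
  then have "?f j < x $ j * inverse (u $ j)"
    using u uv by (intro mult_strict_left_mono less_imp_inverse_less) auto
  also have "\<dots> \<le> (MAX i. x $ i * inverse (u $ i))" by simp
  finally show ?thesis using j by simp
qed

section \<open>Cyclic sweeps\<close>

text \<open>The number of projectors applied is a parameter because the intermediate stages become
  the data of the halfspaces.\<close>

primrec sweep :: "(nat \<Rightarrow> (real ^ 'n) set) \<Rightarrow> nat \<Rightarrow> real ^ 'n \<Rightarrow> real ^ 'n" where
  "sweep V 0 x = x"
| "sweep V (Suc i) x = relaxed_projector (V (Suc i)) (sweep V i x)"

text \<open>The vector \<open>y\<close> is a minimum of iterates of 1 with increasing weights.
  Applying \<open>T\<close> shifts each iterate to the next, whose weight is strictly larger; the
  last one wraps around to the first because its entries are below 1/2.\<close>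

lemma exists_strict_decrease:
  fixes T :: "real ^ 'n \<Rightarrow> real ^ 'n"
  assumes mono: "\<And>x y. 0 \<le> x \<Longrightarrow> x \<le> y \<Longrightarrow> T x \<le> T y"
    and pos: "\<And>x. \<forall>i. 0 < x $ i \<Longrightarrow> \<forall>i. 0 < T x $ i"
    and scale: "\<And>c x. 0 \<le> x \<Longrightarrow> 0 < c \<Longrightarrow> T (c *\<^sub>R x) \<le> c *\<^sub>R T x"
    and small: "\<forall>i. (T ^^ N) 1 $ i < 1/2"
  shows "\<exists>y. (\<forall>i. 0 < y $ i) \<and> (\<forall>i. T y $ i < y $ i)"
proof -
  have "N \<noteq> 0" using small by (cases N) auto
  \<comment> \<open>The weights start at 1 and stay below 2 for \<open>j\<close> < \<open>N\<close>,
    which is what the threshold 1/2 allows.\<close>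
  define a where "a j = 1 + real j / real N" for j
  define z where "z j = (T ^^ j) 1" for j
  define y where "y = (\<chi> i. MIN j\<in>{..<N}. a j * z j $ i)"
  have a: "0 < a j" "a j < a (Suc j)" "j < N \<Longrightarrow> a j < 2" for j
    using \<open>N \<noteq> 0\<close> by (auto simp: a_def field_simps add_pos_nonneg)
  have z: "\<forall>i. 0 < z j $ i" for j unfolding z_def by (induction j) (use pos in auto)
  have ne: "finite ((\<lambda>j. a j * z j $ i) ` {..<N})" "(\<lambda>j. a j * z j $ i) ` {..<N} \<noteq> {}" for i
    using \<open>N \<noteq> 0\<close> by auto
  have y_pos: "\<forall>i. 0 < y $ i" using a z ne by (simp add: y_def)
  have Ty: "T y \<le> a j *\<^sub>R z (Suc j)" if "j < N" for j
  proof -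
    have "y \<le> a j *\<^sub>R z j" using that by (auto simp: y_def less_eq_vec_def)
    then have "T y \<le> T (a j *\<^sub>R z j)" using y_pos
      by (intro mono) (auto simp: less_eq_vec_def less_imp_le)
    also have "\<dots> \<le> a j *\<^sub>R T (z j)" using z a
      by (intro scale) (auto simp: less_eq_vec_def less_imp_le)
    finally show ?thesis by (simp add: z_def)
  qed
  have "T y $ i < y $ i" for i
  proof -
    obtain j where j: "j < N" "y $ i = a j * z j $ i" using Min_in[OF ne] by (auto simp: y_def)
    show ?thesis
    proof (cases j)
      \<comment> \<open>The wrap-around: the bound from the last iterate is below 2 * (1/2) = 1, the
        value of \<open>a 0 * z 0 $ i\<close>.\<close>
      case 0
      obtain m where m: "N = Suc m" using \<open>N \<noteq> 0\<close> not0_implies_Suc by blast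
      have "T y $ i \<le> a m * z N $ i" using Ty[of m] m by (simp add: less_eq_vec_def)
      also have "\<dots> < 2 * (1/2)"
        using a[of m] m z[of N] small by (intro mult_strict_mono) (auto simp: z_def less_imp_le)
      finally show ?thesis using j 0 by (simp add: a_def z_def)
    next
      case (Suc m)
      have "T y $ i \<le> a m * z j $ i" using Ty[of m] j Suc by (simp add: less_eq_vec_def)
      also have "\<dots> < a j * z j $ i" using a(2)[of m] z Suc by (intro mult_strict_right_mono) auto
      finally show ?thesis using j by simp
    qed
  qed
  then show ?thesis using y_pos by blast
qed

context
  fixes V :: "nat \<Rightarrow> (real ^ 'n) set" and k :: nat
  assumes V: "\<And>i. i \<in> {1..k} \<Longrightarrow> subsemimodule (V i)" "\<And>i. i \<in> {1..k} \<Longrightarrow> closed (V i)"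
begin

lemma V_Suc: "i < k \<Longrightarrow> subsemimodule (V (Suc i))" "i < k \<Longrightarrow> closed (V (Suc i))"
  using V by auto

lemma sweep_pos: "i \<le> k \<Longrightarrow> \<forall>j. 0 < x $ j \<Longrightarrow> \<forall>j. 0 < sweep V i x $ j"
  by (induction i) (auto intro!: relaxed_projector_pos V_Suc)

lemma sweep_nonneg:
  assumes "i \<le> k" "0 \<le> x"
  shows "0 \<le> sweep V i x"
  using assms
proof (induction i)
  case (Suc i)
  then have "0 \<le> (1/2) *\<^sub>R sweep V i x" by (simp add: less_eq_vec_def)
  then show ?case
    by (auto simp: relaxed_projector_def less_eq_vec_def le_max_iff_disj)
qed auto

lemma sweep_decreasing:
  assumes "i \<le> j" "j \<le> k" "0 \<le> x"
  shows "sweep V j x \<le> sweep V i x"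
  using assms
proof (induction j rule: dec_induct)
  case (step j)
  then have "sweep V (Suc j) x \<le> sweep V j x"
    by (simp add: relaxed_projector_le V_Suc sweep_nonneg)
  then show ?case using step by simp
qed simp

lemma sweep_mono:
  assumes "i \<le> k" "0 \<le> x" "x \<le> y"
  shows "sweep V i x \<le> sweep V i y"
  using assms by (induction i) (auto intro!: relaxed_projector_mono V_Suc sweep_nonneg)

lemma sweep_scale_le:
  assumes "i \<le> k" "0 \<le> x" "0 < c"
  shows "sweep V i (c *\<^sub>R x) \<le> c *\<^sub>R sweep V i x"
  using assms
proof (induction i)
  case (Suc i)
  have "0 \<le> c *\<^sub>R x" using Suc.prems by (simp add: less_eq_vec_def)
  then have "sweep V (Suc i) (c *\<^sub>R x) \<le> relaxed_projector (V (Suc i)) (c *\<^sub>R sweep V i x)"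
    using Suc by (auto intro!: relaxed_projector_mono V_Suc sweep_nonneg)
  also have "\<dots> \<le> c *\<^sub>R sweep V (Suc i) x"
    using Suc.prems by (auto intro!: relaxed_projector_scale_le V_Suc sweep_nonneg)
  finally show ?case .
qed simp

text \<open>The iterates decrease and are bounded below by 0, so they converge entrywise. Every
  stage within a sweep is squeezed between two successive iterates and has the same limit.\<close>

lemma sweep_iterates_tendsto_Inter:
  assumes e: "0 \<le> e"
  shows "\<exists>w\<in>(\<Inter>i\<in>{1..k}. V i). (\<lambda>m. (sweep V k ^^ m) e) \<longlonglongrightarrow> w"
proof -
  define z where "z m = (sweep V k ^^ m) e" for m
  have z: "0 \<le> z m" for m unfolding z_def by (induction m) (use e sweep_nonneg in auto)
  have dec: "z (Suc m) \<le> z m" for m using sweep_decreasing[of 0 k "z m"] z by (simp add: z_def)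
  have "\<exists>l. (\<lambda>m. z m $ i) \<longlonglongrightarrow> l" for i
  proof -
    have "decseq (\<lambda>m. z m $ i)" using dec by (intro decseq_SucI) (simp add: less_eq_vec_def)
    moreover have "0 \<le> z m $ i" for m using z by (simp add: less_eq_vec_def)
    ultimately show ?thesis using decseq_convergent[of "\<lambda>m. z m $ i" 0] by metis
  qed
  then obtain l where l: "\<And>i. (\<lambda>m. z m $ i) \<longlonglongrightarrow> l i" by metis
  define w where "w = (\<chi> i. l i)"
  have zi: "(\<lambda>m. z m $ i) \<longlonglongrightarrow> w $ i" for i using l by (simp add: w_def)
  have lim: "z \<longlonglongrightarrow> w" using zi by (rule vec_tendstoI)
  have sweep_lim: "(\<lambda>m. sweep V i (z m)) \<longlonglongrightarrow> w" if "i \<le> k" for i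
  proof (rule vec_tendstoI)
    fix j
    have "z (Suc m) $ j \<le> sweep V i (z m) $ j" "sweep V i (z m) $ j \<le> z m $ j" for m
      using sweep_decreasing[of i k "z m"] sweep_decreasing[of 0 i "z m"] that z[of m]
      by (auto simp: less_eq_vec_def z_def)
    then show "(\<lambda>m. sweep V i (z m) $ j) \<longlonglongrightarrow> w $ j"
      by (intro tendsto_sandwich[OF _ _ LIMSEQ_Suc[OF zi] zi]) auto
  qed
  \<comment> \<open>The input and output of the projector of \<open>V (Suc i)\<close> are
    consecutive stages with common limit \<open>w\<close>, so
    \<open>relaxed_projector_limit_in\<close> applies.\<close>
  have "w \<in> V (Suc i)" if "i < k" for i
    using relaxed_projector_limit_in[OF V_Suc(1)[OF that] V_Suc(2)[OF that],
        of "\<lambda>m. sweep V i (z m)"] sweep_lim[of i] sweep_lim[of "Suc i"] that z sweep_nonneg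
    by simp
  then have "w \<in> V i" if "i \<in> {1..k}" for i using that by (cases i) auto
  then show ?thesis using lim unfolding z_def by blast
qed

text \<open>The limit of the iterates of 1 can only be 0. With finitely many coordinates, a single
  iterate has all its entries below 1/2.\<close>

lemma exists_sweep_less:
  assumes "(\<Inter>i\<in>{1..k}. V i) = {0}"
  shows "\<exists>y. (\<forall>i. 0 < y $ i) \<and> (\<forall>i. sweep V k y $ i < y $ i)"
proof -
  have "(\<lambda>m. (sweep V k ^^ m) 1) \<longlonglongrightarrow> 0"
    using sweep_iterates_tendsto_Inter[of 1] assms by (auto simp: less_eq_vec_def)
  then have "\<forall>\<^sub>F m in sequentially. (sweep V k ^^ m) 1 $ i < 1/2" for i
    using tendsto_vec_nth[of _ 0 _ i] by (intro order_tendstoD) fastforce+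
  then have "\<forall>\<^sub>F m in sequentially. \<forall>i. (sweep V k ^^ m) 1 $ i < 1/2"
    by (rule eventually_all_finite)
  then obtain N where "\<forall>i. (sweep V k ^^ N) 1 $ i < 1/2"
    by (auto simp: eventually_sequentially)
  then show ?thesis
    by (intro exists_strict_decrease) (auto intro!: sweep_mono sweep_scale_le simp: sweep_pos)
qed

end

theorem theorem21:
  fixes V :: "nat \<Rightarrow> (real ^ 'n) set" and k :: nat
  assumes "\<And>i. i \<in> {1..k} \<Longrightarrow> subsemimodule (V i)"
    and "\<And>i. i \<in> {1..k} \<Longrightarrow> closed (V i)"
    and "(\<Inter>i\<in>{1..k}. V i) = {0}"
  shows "\<exists>H :: nat \<Rightarrow> (real ^ 'n) set.
           (\<forall>i\<in>{1..k}. archimedean_halfspace (H i) \<and> V i \<subseteq> H i) \<and>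
           (\<Inter>i\<in>{1..k}. H i) = {0}"
proof -
  obtain y where y: "\<forall>i. 0 < y $ i" and less: "\<forall>i. sweep V k y $ i < y $ i"
    using exists_sweep_less[OF assms] by auto
  define s where "s i = sweep V i y" for i
  \<comment> \<open>Each halfspace compares two consecutive stages, beginning with
    \<open>s 0 = y\<close>, so that the inequalities chain.\<close>
  define H where "H i = halfspace (s i) (s (i - 1))" for i
  have s_pos: "\<forall>j. 0 < s i $ j" if "i \<le> k" for i
    using sweep_pos[OF assms(1,2) that y] by (simp add: s_def)
  have y_nonneg: "0 \<le> y" using y by (simp add: less_eq_vec_def less_imp_le)
  have arch: "archimedean_halfspace (H i)" if "i \<in> {1..k}" for i
  proof -
    have "\<forall>j. s i $ j \<le> s (i - 1) $ j"
      using sweep_decreasing[where i = "i - 1" and j = i, OF assms(1,2) _ _ y_nonneg] that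
      by (simp add: s_def less_eq_vec_def)
    moreover have "\<forall>j. 0 < s i $ j" "\<forall>j. 0 < s (i - 1) $ j" using s_pos that by auto
    ultimately show ?thesis unfolding archimedean_halfspace_def H_def halfspace_def by blast
  qed
  have sub: "V i \<subseteq> H i" if i: "i \<in> {1..k}" for i
  proof -
    have "s i = relaxed_projector (V i) (s (i - 1))" using i by (cases i) (auto simp: s_def)
    moreover have "\<forall>j. 0 < s (i - 1) $ j" using s_pos i by auto
    ultimately show ?thesis
      using subset_halfspace_relaxed_projector[OF assms(1)[OF i] assms(2)[OF i]]
      unfolding H_def by metis
  qed
  \<comment> \<open>An empty intersection would be the whole space. For \<open>k\<close> > 0,
    membership in \<open>H k\<close> makes \<open>x\<close> nonnegative.\<close>
  have "k \<noteq> 0"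
  proof
    assume "k = 0"
    then have "(1 :: real ^ 'n) \<in> {0}" using assms(3) by auto
    then show False by simp
  qed
  have "x = 0" if x: "x \<in> (\<Inter>i\<in>{1..k}. H i)" for x
  proof (rule ccontr)
    assume "x \<noteq> 0"
    let ?M = "\<lambda>i. MAX j. x $ j * inverse (s i $ j)"
    \<comment> \<open>Membership of \<open>x\<close> in the successive halfspaces makes the maximal
      quotients nonincreasing in \<open>i\<close>.\<close>
    have "?M i \<le> ?M 0" if "i \<le> k" for i
      using that
    proof (induction i)
      case (Suc i)
      then have "x \<in> H (Suc i)" using x by auto
      then have "?M (Suc i) \<le> ?M i" by (simp add: H_def halfspace_def)
      also have "\<dots> \<le> ?M 0" using Suc by (intro Suc.IH) simp
      finally show ?case .
    qed simp
    moreover have "x \<in> H k" using x \<open>k \<noteq> 0\<close> by auto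
    then have "x \<in> nonneg_vecs" by (simp add: H_def halfspace_def)
    \<comment> \<open>The strict decrease from \<open>s 0 = y\<close> to \<open>s k\<close> forces
      the opposite strict inequality for nonzero \<open>x\<close>.\<close>
    then have "?M 0 < ?M k"
      using \<open>x \<noteq> 0\<close> s_pos[of k] less by (intro max_quotient_less) (auto simp: s_def)
    ultimately show False using leD by blast
  qed
  moreover have "0 \<in> (\<Inter>i\<in>{1..k}. H i)"
    by (simp add: H_def halfspace_def nonneg_vecs_def)
  ultimately have "(\<Inter>i\<in>{1..k}. H i) = {0}" by blast
  then show ?thesis using arch sub by blast
qed

end
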